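(* Let $q$ be a prime power, $V$ an $\mathbb{F}_q$-vector space of dimension $v$, $D$ a $t$-$(v,k,\lambda)_q$ subspace design in $V$, $S$ a subspace of $V$ and $s=\dim(S)$. Then for every $i\in\{0,\ldots,t\}$, the intersection numbers $\alpha_j=\alpha_j(S)$ satisfy \[ \alpha_i=\begin{bmatrix} s\\ i\end{bmatrix}_q\sum_{j=i}^{t}(-1)^{j-i}q^{\binom{j-i}{2}}\begin{bmatrix} s-i\\ j-i\end{bmatrix}_q\lambda_j+(-1)^{t+1-i}q^{\binom{t+1-i}{2}}\sum_{j=t+1}^{k}\begin{bmatrix} j\\ i\end{bmatrix}_q\begin{bmatrix} j-i-1\\ t-i\end{bmatrix}_q\alpha_j , \] so that $\alpha_0,\ldots,\alpha_t$ are expressed in terms of $\alpha_{t+1},\ldots,\alpha_k$.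
   Context: Gaussian binomial coefficients: $\begin{bmatrix} n\\ k\end{bmatrix}_q=\prod_{j=1}^{k}\frac{q^{n-k+j}-1}{q^j-1}$ for $0\le k\le n$ and $0$ otherwise. A $t$-$(v,k,\lambda)_q$ subspace design is a set $D$ of $k$-dimensional subspaces (blocks) of $V$ such that each $t$-dimensional subspace of $V$ lies in exactly $\lambda$ blocks. $\alpha_j(S)=\#\{B\in D\mid\dim(B\cap S)=j\}$. For $j\in\{0,\ldots,t\}$, $\lambda_j=\frac{\begin{bmatrix} v-j\\ t-j\end{bmatrix}_q}{\begin{bmatrix} k-j\\ t-j\end{bmatrix}_q}\lambda$. *)

theory Defs
  imports Complex_Main "HOL-Library.Cardinality"
begin

definition gauss_binomial :: "nat \<Rightarrow> nat \<Rightarrow> nat \<Rightarrow> real" where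
  "gauss_binomial q n k =
     (if k \<le> n then \<Prod>j=1..k. (real q ^ (n - k + j) - 1) / (real q ^ j - 1) else 0)"

text \<open>
  The ambient space \<open>V\<close> is the whole type \<^typ>\<open>'a\<close>, with scalar multiplication \<open>scale\<close>.
  The dimension \<open>v\<close> is a parameter of the design, as in the notation \<open>t-(v,k,\<lambda>)\<^sub>q\<close>.
\<close>

definition subspace_design ::
  "('f::{field,finite} \<Rightarrow> 'a::ab_group_add \<Rightarrow> 'a) \<Rightarrow> nat \<Rightarrow> nat \<Rightarrow> nat \<Rightarrow> nat \<Rightarrow> 'a set set \<Rightarrow> bool" where
  "subspace_design scale t v k lam D \<longleftrightarrow>
     vector_space.dim scale (UNIV :: 'a set) = v \<and>
     (\<forall>B\<in>D. module.subspace scale B \<and> vector_space.dim scale B = k) \<and>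
     (\<forall>T. module.subspace scale T \<and> vector_space.dim scale T = t \<longrightarrow>
        card {B \<in> D. T \<subseteq> B} = lam)"

definition intersection_number ::
  "('f::field \<Rightarrow> 'a::ab_group_add \<Rightarrow> 'a) \<Rightarrow> 'a set set \<Rightarrow> 'a set \<Rightarrow> nat \<Rightarrow> nat" where
  "intersection_number scale D S j = card {B \<in> D. vector_space.dim scale (B \<inter> S) = j}"

definition design_lambda :: "nat \<Rightarrow> nat \<Rightarrow> nat \<Rightarrow> nat \<Rightarrow> nat \<Rightarrow> nat \<Rightarrow> real" where
  "design_lambda q t v k lam j =
     gauss_binomial q (v - j) (t - j) / gauss_binomial q (k - j) (t - j) * real lam"

end

theory Submission
  imports Defs
begin

text \<open>
  Counting pairs \<open>(J, B)\<close> with \<open>J \<subseteq> B \<inter> S\<close> and \<open>dim J = j\<close>, for blocks \<open>B\<close>, gives the \<open>q\<close>-analogue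
  of the Mendelsohn equations
  \<open>[s, j]\<^sub>q \<lambda>\<^sub>j = (\<Sum>m. [m, j]\<^sub>q \<alpha>\<^sub>m)\<close> for \<open>j \<le> t\<close>.
  Taking the alternating combination of the equations with \<open>i \<le> j \<le> t\<close>, the coefficient of \<open>\<alpha>\<^sub>m\<close> becomes
  \<open>[m, i]\<^sub>q\<close> times a truncated alternating sum of Gaussian binomials, which telescopes by the
  \<open>q\<close>-Pascal rule.
\<close>

section \<open>Gaussian binomial coefficients\<close>

text \<open>This is (q - 1)^n times the usual q-factorial. The powers of q - 1 cancel in the
  quotient that expresses a Gaussian binomial.\<close>

definition q_factorial :: "nat \<Rightarrow> nat \<Rightarrow> real" where
  "q_factorial q n = (\<Prod>j=1..n. real q ^ j - 1)"

lemma q_factorial_0 [simp]: "q_factorial q 0 = 1"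
  by (simp add: q_factorial_def)

lemma q_factorial_Suc: "q_factorial q (Suc n) = q_factorial q n * (real q ^ Suc n - 1)"
  by (simp add: q_factorial_def)

lemma power_minus_one_nonzero:
  assumes "q \<ge> 2" "j \<ge> 1"
  shows "real q ^ j - 1 \<noteq> 0"
proof -
  have "1 < real q ^ j"
    using assms by (intro one_less_power) auto
  then show ?thesis by simp
qed

lemma q_factorial_nonzero:
  assumes "q \<ge> 2"
  shows "q_factorial q n \<noteq> 0"
  using power_minus_one_nonzero[OF assms] by (simp add: q_factorial_def)

text \<open>For \<open>m = n - k\<close> the product on the right is the numerator in
  \<open>gauss_binomial\<close>.\<close>

lemma q_factorial_add:
  "q_factorial q (m + k) = q_factorial q m * (\<Prod>j=1..k. real q ^ (m + j) - 1)"
  by (induction k) (simp_all add: q_factorial_Suc)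

lemma gauss_binomial_eq_0: "n < k \<Longrightarrow> gauss_binomial q n k = 0"
  by (simp add: gauss_binomial_def)

lemma gauss_binomial_0_right [simp]: "gauss_binomial q n 0 = 1"
  by (simp add: gauss_binomial_def)

lemma gauss_binomial_q_factorial:
  assumes "q \<ge> 2" "k \<le> n"
  shows "gauss_binomial q n k = q_factorial q n / (q_factorial q k * q_factorial q (n - k))"
  using assms q_factorial_add[of q "n - k" k] q_factorial_nonzero[of q "n - k"]
  by (simp add: gauss_binomial_def prod_dividef q_factorial_def[of q k])

lemma gauss_binomial_self [simp]:
  assumes "q \<ge> 2"
  shows "gauss_binomial q n n = 1"
  using assms by (simp add: gauss_binomial_q_factorial q_factorial_nonzero)

lemma gauss_binomial_nonzero:
  assumes "q \<ge> 2" "k \<le> n"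
  shows "gauss_binomial q n k \<noteq> 0"
  using assms by (simp add: gauss_binomial_q_factorial q_factorial_nonzero)

text \<open>Over a common denominator this is q^(a+b) - 1 = (q^a - 1) + q^a (q^b - 1) with a = k + 1
  and b = n - k.\<close>

lemma gauss_binomial_Suc_Suc:
  assumes q: "q \<ge> 2"
  shows "gauss_binomial q (Suc n) (Suc k) =
    gauss_binomial q n k + real q ^ Suc k * gauss_binomial q n (Suc k)"
proof -
  \<comment> \<open>The case \<open>n = k\<close> stands apart because
    \<open>gauss_binomial q n (Suc k)\<close> then takes the default value 0, outside the range of
    the factorial quotient.\<close>
  consider "n < k" | "n = k" | d where "n = Suc (k + d)"
    by (metis add_Suc_right less_imp_Suc_add linorder_neqE_nat)
  then show ?thesis
  proof cases
    case 3
    have nz: "q_factorial q k \<noteq> 0" "q_factorial q d \<noteq> 0"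
      "real q ^ Suc k - 1 \<noteq> 0" "real q ^ Suc d - 1 \<noteq> 0"
      using q_factorial_nonzero[OF q] power_minus_one_nonzero[OF q, of "Suc _"] by (blast, blast, simp_all)
    have a: "gauss_binomial q (Suc n) (Suc k) =
        q_factorial q n * (real q ^ (Suc k + Suc d) - 1) /
        (q_factorial q k * (real q ^ Suc k - 1) * (q_factorial q d * (real q ^ Suc d - 1)))"
      using 3 q by (simp add: gauss_binomial_q_factorial Suc_diff_le q_factorial_Suc[of q "Suc (k + d)"]
          q_factorial_Suc[of q k] q_factorial_Suc[of q d])
    have b: "gauss_binomial q n k =
        q_factorial q n / (q_factorial q k * (q_factorial q d * (real q ^ Suc d - 1)))"
      using 3 q by (simp add: gauss_binomial_q_factorial Suc_diff_le q_factorial_Suc[of q d])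
    have c: "gauss_binomial q n (Suc k) =
        q_factorial q n / (q_factorial q k * (real q ^ Suc k - 1) * q_factorial q d)"
      using 3 q by (simp add: gauss_binomial_q_factorial q_factorial_Suc[of q k])
    show ?thesis
      unfolding a b c power_add using nz by (simp add: divide_simps) (simp add: algebra_simps)
  qed (use q in \<open>simp_all add: gauss_binomial_eq_0\<close>)
qed

text \<open>Both sides count flags of an i-subspace inside a j-subspace of an n-space. In
  factorials, both are [n]! / ([i]! [j-i]! [n-j]!); for j > n both vanish.\<close>

lemma gauss_binomial_mult_diff:
  assumes "q \<ge> 2" "i \<le> j"
  shows "gauss_binomial q n i * gauss_binomial q (n - i) (j - i) =
    gauss_binomial q n j * gauss_binomial q j i"
proof (cases "j \<le> n")
  case True
  then show ?thesis
    using assms by (simp add: gauss_binomial_q_factorial q_factorial_nonzero)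
next
  case False
  then show ?thesis
    using assms by (cases "i \<le> n") (simp_all add: gauss_binomial_eq_0)
qed

text \<open>The q-analogue of the partial alternating row sums of Pascal's triangle. For r > n it
  says that the complete alternating sum is 0.\<close>

lemma alternating_gauss_binomial_sum:
  assumes "q \<ge> 2"
  shows "(\<Sum>l\<le>r. (- 1) ^ l * real q ^ (l choose 2) * gauss_binomial q (Suc n) l) =
    (- 1) ^ r * real q ^ (Suc r choose 2) * gauss_binomial q n r"
proof (induction r)
  case 0
  then show ?case by (simp add: binomial_eq_0)
next
  case (Suc r)
  \<comment> \<open>The weight q^(r+1) in the q-Pascal rule is exactly the increment between the two
    exponents.\<close>
  have "Suc (Suc r) choose 2 = (Suc r choose 2) + Suc r"
    by (simp add: numeral_2_eq_2)
  with Suc gauss_binomial_Suc_Suc[OF assms, of n r] show ?case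
    by (simp add: power_add algebra_simps)
qed

text \<open>The previous sum with r = t - i and n = m - i - 1. The right side vanishes for i < m
  \<le> t and yields the remaining coefficients for m > t.\<close>

lemma alternating_gauss_binomial_sum_shifted:
  assumes q: "q \<ge> 2" and "i \<le> t" "i < m"
  shows "(\<Sum>j=i..t. (- 1) ^ (j - i) * real q ^ ((j - i) choose 2) * gauss_binomial q (m - i) (j - i)) =
    - ((- 1) ^ (t + 1 - i) * real q ^ ((t + 1 - i) choose 2) * gauss_binomial q (m - i - 1) (t - i))"
proof -
  obtain r where r: "t = i + r" using \<open>i \<le> t\<close> le_Suc_ex by blast
  obtain n where n: "m = i + Suc n" using \<open>i < m\<close> by (metis add_Suc_right less_imp_Suc_add)
  have "(\<Sum>j=i..t. (- 1) ^ (j - i) * real q ^ ((j - i) choose 2) * gauss_binomial q (m - i) (j - i)) =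
      (\<Sum>l\<le>r. (- 1) ^ l * real q ^ (l choose 2) * gauss_binomial q (Suc n) l)"
    using r n by (intro sum.reindex_bij_witness[of _ "\<lambda>l. l + i" "\<lambda>j. j - i"]) auto
  then show ?thesis
    using alternating_gauss_binomial_sum[OF q] r n by simp
qed

section \<open>Counting subspaces\<close>

lemma sum_card_swap:
  assumes "finite A" "finite B"
  shows "(\<Sum>x\<in>A. card {y \<in> B. R x y}) = (\<Sum>y\<in>B. card {x \<in> A. R x y})"
  using sum.swap_restrict[OF assms, of "\<lambda>_ _. 1::nat" R] by simp

locale finite_vector_space = finite_dimensional_vector_space scale Basis
  for scale :: "'f::{field,finite} \<Rightarrow> 'a::ab_group_add \<Rightarrow> 'a"  (infixr \<open>*s\<close> 75)
    and Basis :: "'a set" +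
  fixes q :: nat
  assumes q_eq_card: "q = CARD('f)"
begin

section \<open>Sizes of subspaces over a finite field\<close>

lemma q_ge_2: "q \<ge> 2"
proof -
  have "card {0::'f, 1} \<le> q"
    unfolding q_eq_card by (intro card_mono) auto
  then show ?thesis by simp
qed

text \<open>The span is the union of the cosets c x + J over the q scalars c, which are distinct
  because x lies outside J.\<close>

lemma card_span_insert:
  assumes J: "subspace J" and x: "x \<notin> J" and fin: "finite J"
  shows "finite (span (insert x J))" "card (span (insert x J)) = q * card J"
proof -
  let ?f = "\<lambda>(c, y). c *s x + y"
  have "inj_on ?f (UNIV \<times> J)"
  proof (rule inj_onI, clarify)
    fix c y c' y'
    assume y: "y \<in> J" "y' \<in> J" and eq: "c *s x + y = c' *s x + y'"
    have d: "(c - c') *s x = y' - y"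
      using eq by (simp add: scale_left_diff_distrib algebra_simps)
    have "c = c'"
    proof (rule ccontr)
      assume "c \<noteq> c'"
      then have "x = inverse (c - c') *s ((c - c') *s x)" by simp
      also have "\<dots> \<in> J"
        unfolding d using J y by (intro subspace_scale subspace_diff)
      finally show False using x by simp
    qed
    with eq show "c = c' \<and> y = y'" by simp
  qed
  moreover have "?f ` (UNIV \<times> J) = span (insert x J)"
  proof
    show "?f ` (UNIV \<times> J) \<subseteq> span (insert x J)"
      by (auto intro!: span_add span_scale intro: span_base)
    show "span (insert x J) \<subseteq> ?f ` (UNIV \<times> J)"
    proof
      fix y assume "y \<in> span (insert x J)"
      then obtain c where "y - c *s x \<in> J"
        using iffD2[OF span_eq_iff J] by (auto simp: span_insert)
      then show "y \<in> ?f ` (UNIV \<times> J)"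
        by (intro image_eqI[of _ _ "(c, y - c *s x)"]) auto
    qed
  qed
  ultimately have b: "bij_betw ?f (UNIV \<times> J) (span (insert x J))"
    by (simp add: bij_betw_def)
  show "finite (span (insert x J))"
    using bij_betw_finite[OF b] fin by (simp add: finite_cartesian_product)
  show "card (span (insert x J)) = q * card J"
    using bij_betw_same_card[OF b] by (simp add: card_cartesian_product q_eq_card)
qed

lemma card_span_independent:
  assumes "finite B" "independent B"
  shows "finite (span B) \<and> card (span B) = q ^ card B"
  using assms
proof (induction B rule: finite_induct)
  case empty
  then show ?case by simp
next
  case (insert x B)
  then have ind: "independent B" "x \<notin> span B"
    by (auto simp: independent_insert)
  have "span (insert x (span B)) = span (insert x B)"
    by (simp add: span_insert span_span)
  with card_span_insert[of "span B" x] ind insert show ?case by auto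
qed

lemma finite_set [simp]: "finite (A :: 'a set)"
  using card_span_independent[OF finite_Basis independent_Basis] span_Basis
  by (metis finite_subset subset_UNIV)

text \<open>Supplies the finiteness of the block set and of all families of subspaces, on which the
  double counts rely.\<close>

lemma finite_set_set [simp]: "finite (\<A> :: 'a set set)"
  by (rule finite_subset[OF _ finite_Pow_iff[THEN iffD2, OF finite_set[of UNIV]]]) auto

lemma card_subspace:
  assumes "subspace W"
  shows "card W = q ^ dim W"
proof -
  obtain B where B: "B \<subseteq> W" "independent B" "W \<subseteq> span B" "card B = dim W"
    using basis_exists by blast
  then have "span B = W"
    using assms by (meson span_subspace)
  then show ?thesis using card_span_independent[of B] B by auto
qed

lemma dim_span_insert:
  assumes "subspace J" "x \<notin> J"
  shows "dim (span (insert x J)) = Suc (dim J)"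
proof -
  have "span J = J" using assms by simp
  with assms(2) show ?thesis by (simp only: dim_span dim_insert if_False)
qed

section \<open>Counting subspaces through ordered bases\<close>

text \<open>\<open>extends J xs\<close>: the list \<open>xs\<close> is an ordered basis of a complement of \<open>J\<close> in \<open>span (J \<union> set xs)\<close>.\<close>

primrec extends :: "'a set \<Rightarrow> 'a list \<Rightarrow> bool" where
  "extends J [] \<longleftrightarrow> True"
| "extends J (x # xs) \<longleftrightarrow> x \<notin> J \<and> extends (span (insert x J)) xs"

lemma span_insert_Un: "span (span (insert x J) \<union> A) = span (J \<union> insert x A)"
proof -
  have "span (span (insert x J) \<union> A) = span (insert x J \<union> A)"
    unfolding span_Un span_span ..
  then show ?thesis by simp
qed

lemma dim_extends:
  "subspace J \<Longrightarrow> extends J xs \<Longrightarrow> dim (span (J \<union> set xs)) = dim J + length xs"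
proof (induction xs arbitrary: J)
  case Nil
  then show ?case by simp
next
  case (Cons x xs)
  then have "dim (span (span (insert x J) \<union> set xs)) = Suc (dim J) + length xs"
    by (simp add: dim_span_insert del: dim_span)
  then show ?case
    by (simp add: span_insert_Un del: dim_span)
qed

lemma finite_lists_of_length [simp]: "finite {xs :: 'a list. length xs = m \<and> P xs}"
  by (rule finite_subset[OF _ finite_lists_length_eq[of "UNIV :: 'a set" m]]) auto

text \<open>After i entries the span has q^(dim J + i) elements, and the next entry is any vector of
  W outside it. If m exceeds dim W - dim J, some factor is 0, as it should be.\<close>

lemma card_extends:
  assumes "subspace J" "subspace W" "J \<subseteq> W"
  shows "real (card {xs. length xs = m \<and> extends J xs \<and> set xs \<subseteq> W}) =
    (\<Prod>i<m. real q ^ dim W - real q ^ (dim J + i))"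
  using assms
proof (induction m arbitrary: J)
  case 0
  have "{xs. length xs = 0 \<and> extends J xs \<and> set xs \<subseteq> W} = {[]}" by auto
  then show ?case by simp
next
  case (Suc m)
  let ?L = "\<lambda>J m. {xs. length xs = m \<and> extends J xs \<and> set xs \<subseteq> W}"
  have "?L J (Suc m) = (\<lambda>(x, xs). x # xs) ` (SIGMA x:W - J. ?L (span (insert x J)) m)"
    by (auto simp: length_Suc_conv image_iff)
  moreover have "inj_on (\<lambda>(x, xs). x # xs) (SIGMA x:W - J. ?L (span (insert x J)) m)"
    by (auto simp: inj_on_def)
  ultimately have "card (?L J (Suc m)) = (\<Sum>x\<in>W - J. card (?L (span (insert x J)) m))"
    by (simp add: card_image)
  moreover have "real (card (?L (span (insert x J)) m)) =
      (\<Prod>i<m. real q ^ dim W - real q ^ (dim J + Suc i))" if "x \<in> W - J" for x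
  proof -
    have "span (insert x J) \<subseteq> W"
      using that Suc.prems by (intro span_minimal) auto
    then show ?thesis
      using Suc.IH[of "span (insert x J)"] Suc.prems that
      by (simp add: dim_span_insert del: dim_span)
  qed
  ultimately have "real (card (?L J (Suc m))) =
      real (card (W - J)) * (\<Prod>i<m. real q ^ dim W - real q ^ (dim J + Suc i))"
    by simp
  moreover have "real (card (W - J)) = real q ^ dim W - real q ^ dim J"
    using Suc.prems card_mono[of W J]
    by (simp add: card_Diff_subset card_subspace of_nat_diff)
  ultimately show ?case
    by (simp add: prod.lessThan_Suc_shift del: prod.lessThan_Suc)
qed

text \<open>Compares the numbers of ordered extensions inside spaces of dimensions w and j + m; the
  powers q^(j+i) cancel factor by factor.\<close>

lemma extension_count_quotient:
  assumes "j \<le> w"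
  shows "(\<Prod>i<m. real q ^ w - real q ^ (j + i)) =
    gauss_binomial q (w - j) m * (\<Prod>i<m. real q ^ (j + m) - real q ^ (j + i))"
proof (cases "m \<le> w - j")
  case False
  then have "w - j \<in> {..<m}" by simp
  then have "(\<Prod>i<m. real q ^ w - real q ^ (j + i)) = 0"
    using assms by (intro prod_zero bexI[of _ "w - j"]) auto
  with False show ?thesis by (simp add: gauss_binomial_eq_0)
next
  case True
  \<comment> \<open>Reversing the order of the factors aligns them with the order in which the
    extension vectors are chosen.\<close>
  have "gauss_binomial q (w - j) m =
      (\<Prod>i<m. (real q ^ (w - j - i) - 1) / (real q ^ (m - i) - 1))"
    using True unfolding gauss_binomial_def
    by (auto intro!: prod.reindex_bij_witness[of _ "\<lambda>i. m - i" "\<lambda>i. m - i"])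
  moreover have "real q ^ w - real q ^ (j + i) =
      (real q ^ (w - j - i) - 1) / (real q ^ (m - i) - 1) * (real q ^ (j + m) - real q ^ (j + i))"
    if "i < m" for i
  proof -
    have "w = (w - j - i) + (j + i)" "j + m = (m - i) + (j + i)"
      using that True assms by auto
    then have "real q ^ w = real q ^ (w - j - i) * real q ^ (j + i)"
      "real q ^ (j + m) = real q ^ (m - i) * real q ^ (j + i)"
      by (metis power_add)+
    with power_minus_one_nonzero[OF q_ge_2, of "m - i"] that show ?thesis
      by (simp add: divide_simps) (simp add: algebra_simps)
  qed
  ultimately show ?thesis
    by (simp flip: prod.distrib)
qed

text \<open>The ordered extensions of J inside W are sorted by the subspace that they span together
  with J. Each T receives the same number \<open>?F\<close> of them, so the number of T is a
  quotient.\<close>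

lemma card_subspaces_between:
  assumes J: "subspace J" and W: "subspace W" and "J \<subseteq> W" and d: "dim J \<le> d"
  shows "real (card {T. subspace T \<and> dim T = d \<and> J \<subseteq> T \<and> T \<subseteq> W}) =
    gauss_binomial q (dim W - dim J) (d - dim J)"
proof -
  define m where "m = d - dim J"
  let ?L = "\<lambda>W. {xs. length xs = m \<and> extends J xs \<and> set xs \<subseteq> W}"
  let ?\<T> = "{T. subspace T \<and> dim T = d \<and> J \<subseteq> T \<and> T \<subseteq> W}"
  let ?F = "\<Prod>i<m. real q ^ (dim J + m) - real q ^ (dim J + i)"
  \<comment> \<open>A list determines its T, since the span lies in T and has the same dimension;
    hence the classes are disjoint.\<close>
  have span_L: "span (J \<union> set xs) = T"
    if "xs \<in> ?L T" "subspace T" "dim T = d" "J \<subseteq> T" for xs T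
  proof (rule subspace_dim_equal)
    show "span (J \<union> set xs) \<subseteq> T"
      using that by (intro span_minimal) auto
    show "dim T \<le> dim (span (J \<union> set xs))"
      using that J d dim_extends[of J xs] by (simp add: m_def del: dim_span)
  qed (use that in auto)
  have "?L W = (\<Union>T\<in>?\<T>. ?L T)"
  proof
    show "?L W \<subseteq> (\<Union>T\<in>?\<T>. ?L T)"
    proof
      fix xs assume xs: "xs \<in> ?L W"
      have "span (J \<union> set xs) \<subseteq> W"
        using xs W \<open>J \<subseteq> W\<close> by (intro span_minimal) auto
      moreover have "dim (span (J \<union> set xs)) = d"
        using xs J d dim_extends[of J xs] by (simp add: m_def del: dim_span)
      ultimately have "span (J \<union> set xs) \<in> ?\<T>"
        by (auto simp del: dim_span intro: span_base)
      moreover have "xs \<in> ?L (span (J \<union> set xs))"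
        using xs by (auto intro: span_base)
      ultimately show "xs \<in> (\<Union>T\<in>?\<T>. ?L T)" by blast
    qed
  qed auto
  moreover have "card (\<Union>T\<in>?\<T>. ?L T) = (\<Sum>T\<in>?\<T>. card (?L T))"
  proof (rule card_UN_disjoint)
    show "\<forall>T\<in>?\<T>. \<forall>T'\<in>?\<T>. T \<noteq> T' \<longrightarrow> ?L T \<inter> ?L T' = {}"
      using span_L by blast
  qed auto
  moreover have "real (card (?L T)) = ?F" if "T \<in> ?\<T>" for T
    using that J d card_extends[of J T m] by (simp add: m_def)
  ultimately have "real (card (?L W)) = real (card ?\<T>) * ?F"
    by simp
  moreover have "real (card (?L W)) = gauss_binomial q (dim W - dim J) m * ?F"
    using card_extends[OF J W \<open>J \<subseteq> W\<close>, of m] extension_count_quotient[of "dim J" "dim W" m]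
      dim_subset[OF \<open>J \<subseteq> W\<close>] by simp
  moreover have "?F \<noteq> 0"
    using q_ge_2 by (auto simp: prod_zero_iff)
  ultimately show ?thesis by (simp add: m_def)
qed

lemma card_subspaces:
  assumes "subspace W"
  shows "real (card {T. subspace T \<and> dim T = d \<and> T \<subseteq> W}) = gauss_binomial q (dim W) d"
proof -
  have "{T. subspace T \<and> dim T = d \<and> T \<subseteq> W} =
      {T. subspace T \<and> dim T = d \<and> {0} \<subseteq> T \<and> T \<subseteq> W}"
    using subspace_0 by auto
  moreover have "dim {0} = 0" by simp
  ultimately show ?thesis
    using card_subspaces_between[of "{0}" W d] assms subspace_0 by simp
qed

section \<open>Subspace designs\<close>

text \<open>Pairs (T, B) with J \<subseteq> T \<subseteq> B and dim T = t are counted twice: each T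
  lies in \<open>lam\<close> blocks, and each block through J contains [k-j, t-j] such T.\<close>

lemma card_blocks_containing:
  assumes D: "subspace_design scale t v k lam D" and "t \<le> k"
    and J: "subspace J" "dim J = j" and "j \<le> t"
  shows "real (card {B \<in> D. J \<subseteq> B}) = design_lambda q t v k lam j"
proof -
  let ?\<T> = "{T. subspace T \<and> dim T = t \<and> J \<subseteq> T \<and> T \<subseteq> UNIV}"
  let ?\<B> = "{B \<in> D. J \<subseteq> B}"
  have "(\<Sum>T\<in>?\<T>. card {B \<in> ?\<B>. T \<subseteq> B}) = (\<Sum>B\<in>?\<B>. card {T \<in> ?\<T>. T \<subseteq> B})"
    by (rule sum_card_swap) auto
  moreover have "card {B \<in> ?\<B>. T \<subseteq> B} = lam" if "T \<in> ?\<T>" for T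
  proof -
    have "{B \<in> ?\<B>. T \<subseteq> B} = {B \<in> D. T \<subseteq> B}" using that by auto
    then show ?thesis using D that by (simp add: subspace_design_def)
  qed
  moreover have "real (card {T \<in> ?\<T>. T \<subseteq> B}) = gauss_binomial q (k - j) (t - j)" if "B \<in> ?\<B>" for B
  proof -
    have "{T \<in> ?\<T>. T \<subseteq> B} = {T. subspace T \<and> dim T = t \<and> J \<subseteq> T \<and> T \<subseteq> B}" by auto
    moreover have "subspace B" "dim B = k" using D that by (auto simp: subspace_design_def)
    ultimately show ?thesis
      using card_subspaces_between[of J B t] J that \<open>j \<le> t\<close> by simp
  qed
  ultimately have "real (card ?\<T>) * real lam = real (card ?\<B>) * gauss_binomial q (k - j) (t - j)"
    by (smt (verit, best) of_nat_mult of_nat_sum sum.cong sum_constant)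
  moreover have "real (card ?\<T>) = gauss_binomial q (v - j) (t - j)"
    using card_subspaces_between[of J UNIV t] J \<open>j \<le> t\<close> D
    by (simp add: subspace_design_def)
  \<comment> \<open>Here \<open>t \<le> k\<close> permits the division that isolates the number of
    blocks.\<close>
  moreover have "gauss_binomial q (k - j) (t - j) \<noteq> 0"
    using q_ge_2 \<open>t \<le> k\<close> by (simp add: gauss_binomial_nonzero)
  ultimately show ?thesis
    by (simp add: design_lambda_def field_simps)
qed

lemma mendelsohn_equation:
  assumes D: "subspace_design scale t v k lam D" and "t \<le> k"
    and S: "subspace S" and "j \<le> t"
  shows "gauss_binomial q (dim S) j * design_lambda q t v k lam j =
    (\<Sum>m\<le>k. gauss_binomial q m j * real (intersection_number scale D S m))"
proof -
  let ?\<J> = "{J. subspace J \<and> dim J = j \<and> J \<subseteq> S}"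
  have "gauss_binomial q (dim S) j * design_lambda q t v k lam j =
      (\<Sum>J\<in>?\<J>. real (card {B \<in> D. J \<subseteq> B}))"
    using card_subspaces[OF S, of j] card_blocks_containing[OF D \<open>t \<le> k\<close> _ _ \<open>j \<le> t\<close>] by simp
  also have "\<dots> = real (\<Sum>J\<in>?\<J>. card {B \<in> D. J \<subseteq> B})" by simp
  also have "\<dots> = real (\<Sum>B\<in>D. card {J \<in> ?\<J>. J \<subseteq> B})"
    by (subst sum_card_swap) auto
  also have "\<dots> = (\<Sum>B\<in>D. gauss_binomial q (dim (B \<inter> S)) j)"
  proof (subst of_nat_sum, rule sum.cong)
    fix B assume "B \<in> D"
    then have "subspace (B \<inter> S)"
      using D S by (auto simp: subspace_design_def intro: subspace_inter)
    moreover have "{J \<in> ?\<J>. J \<subseteq> B} = {J. subspace J \<and> dim J = j \<and> J \<subseteq> B \<inter> S}" by auto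
    ultimately show "real (card {J \<in> ?\<J>. J \<subseteq> B}) = gauss_binomial q (dim (B \<inter> S)) j"
      using card_subspaces by (simp only:)
  qed simp
  \<comment> \<open>Blocks are grouped by the dimension of their intersection with S, which is at
    most k.\<close>
  also have "\<dots> = (\<Sum>m\<le>k. \<Sum>B\<in>{B \<in> D. dim (B \<inter> S) = m}. gauss_binomial q (dim (B \<inter> S)) j)"
  proof (rule sum.group[symmetric])
    have "dim (B \<inter> S) \<le> k" if "B \<in> D" for B
      using D that dim_subset[of "B \<inter> S" B] by (auto simp: subspace_design_def)
    then show "(\<lambda>B. dim (B \<inter> S)) ` D \<subseteq> {..k}" by auto
  qed auto
  also have "\<dots> = (\<Sum>m\<le>k. gauss_binomial q m j * real (intersection_number scale D S m))"
    by (simp add: intersection_number_def mult.commute)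
  finally show ?thesis .
qed

lemma intersection_number_formula:
  assumes D: "subspace_design scale t v k lam D" and "t \<le> k"
    and S: "subspace S" and "i \<le> t"
  shows "real (intersection_number scale D S i) =
      gauss_binomial q (dim S) i *
        (\<Sum>j=i..t. (- 1) ^ (j - i) * real q ^ ((j - i) choose 2) *
           gauss_binomial q (dim S - i) (j - i) * design_lambda q t v k lam j)
      + (- 1) ^ (t + 1 - i) * real q ^ ((t + 1 - i) choose 2) *
        (\<Sum>j=t+1..k. gauss_binomial q j i * gauss_binomial q (j - i - 1) (t - i) *
           real (intersection_number scale D S j))"
proof -
  define \<alpha> where "\<alpha> m = real (intersection_number scale D S m)" for m
  define c where "c j = (- 1) ^ (j - i) * real q ^ ((j - i) choose 2)" for j
  define e where "e = (- 1) ^ (t + 1 - i) * real q ^ ((t + 1 - i) choose 2)"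
  define g where "g = gauss_binomial q"
  \<comment> \<open>The coefficient that \<alpha>_m acquires in the alternating combination of the
    Mendelsohn equations.\<close>
  define C where "C m = g m i * (\<Sum>j=i..t. c j * g (m - i) (j - i))" for m
  have "g (dim S) i * (\<Sum>j=i..t. c j * g (dim S - i) (j - i) * design_lambda q t v k lam j) =
      (\<Sum>j=i..t. c j * g j i * (g (dim S) j * design_lambda q t v k lam j))"
    unfolding sum_distrib_left
  proof (rule sum.cong)
    \<comment> \<open>The flag identity exposes the factor [s, j], which turns each summand into a
      multiple of the left side of a Mendelsohn equation.\<close>
    fix j assume "j \<in> {i..t}"
    then have "g (dim S) i * g (dim S - i) (j - i) = g (dim S) j * g j i"
      using gauss_binomial_mult_diff[OF q_ge_2] by (simp add: g_def)
    then show "g (dim S) i * (c j * g (dim S - i) (j - i) * design_lambda q t v k lam j) =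
        c j * g j i * (g (dim S) j * design_lambda q t v k lam j)"
      by algebra
  qed simp
  also have "\<dots> = (\<Sum>j=i..t. \<Sum>m\<le>k. c j * g j i * (g m j * \<alpha> m))"
    using mendelsohn_equation[OF D \<open>t \<le> k\<close> S] by (simp add: g_def \<alpha>_def sum_distrib_left)
  also have "\<dots> = (\<Sum>m\<le>k. \<Sum>j=i..t. c j * g j i * (g m j * \<alpha> m))"
    by (rule sum.swap)
  also have "\<dots> = (\<Sum>m\<le>k. C m * \<alpha> m)"
    unfolding C_def sum_distrib_left sum_distrib_right
  proof (intro sum.cong refl)
    fix m j assume "j \<in> {i..t}"
    then have "g m i * g (m - i) (j - i) = g m j * g j i"
      using gauss_binomial_mult_diff[OF q_ge_2] by (simp add: g_def)
    then show "c j * g j i * (g m j * \<alpha> m) = g m i * (c j * g (m - i) (j - i)) * \<alpha> m"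
      by algebra
  qed
  also have "\<dots> = (\<Sum>m\<le>t. C m * \<alpha> m) + (\<Sum>m=t+1..k. C m * \<alpha> m)"
  proof -
    have "{..k} = {..t} \<union> {t+1..k}" using \<open>t \<le> k\<close> by auto
    then show ?thesis by (simp add: sum.union_disjoint)
  qed
  \<comment> \<open>Only m = i survives: [m, i] = 0 for m < i, and for i < m \<le> t the telescoped
    sum contains [m-i-1, t-i] = 0.\<close>
  also have "(\<Sum>m\<le>t. C m * \<alpha> m) = (\<Sum>m\<le>t. if m = i then \<alpha> m else 0)"
  proof (rule sum.cong)
    fix m assume m: "m \<in> {..t}"
    consider "m < i" | "m = i" | "i < m" by linarith
    then show "C m * \<alpha> m = (if m = i then \<alpha> m else 0)"
    proof cases
      case 1
      then show ?thesis by (simp add: C_def g_def gauss_binomial_eq_0)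
    next
      case 2
      \<comment> \<open>For m = i the upper index m - i is 0, which kills every term except j =
        i.\<close>
      have "(\<Sum>j=i..t. c j * g 0 (j - i)) = (\<Sum>j=i..t. if j = i then 1 else 0)"
        by (rule sum.cong) (auto simp: c_def g_def gauss_binomial_eq_0 binomial_eq_0)
      with 2 \<open>i \<le> t\<close> q_ge_2 show ?thesis by (simp add: C_def g_def)
    next
      case 3
      then show ?thesis
        using m alternating_gauss_binomial_sum_shifted[OF q_ge_2 \<open>i \<le> t\<close> 3]
        by (simp add: C_def g_def c_def gauss_binomial_eq_0)
    qed
  qed simp
  also have "\<dots> = \<alpha> i" using \<open>i \<le> t\<close> by simp
  \<comment> \<open>The minus sign becomes the plus of the final formula once this sum is moved to
    the other side.\<close>
  also have "(\<Sum>m=t+1..k. C m * \<alpha> m) =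
      - (e * (\<Sum>m=t+1..k. g m i * g (m - i - 1) (t - i) * \<alpha> m))"
    unfolding sum_distrib_left sum_negf[symmetric]
  proof (rule sum.cong)
    fix m assume "m \<in> {t+1..k}"
    then have "i < m" using \<open>i \<le> t\<close> by simp
    then show "C m * \<alpha> m = - (e * (g m i * g (m - i - 1) (t - i) * \<alpha> m))"
      using alternating_gauss_binomial_sum_shifted[OF q_ge_2 \<open>i \<le> t\<close>, of m]
      by (simp add: C_def g_def c_def e_def)
  qed simp
  finally show ?thesis
    by (simp add: \<alpha>_def c_def e_def g_def)
qed

end

theorem theorem2p6:
  fixes scale :: "'f::{field,finite} \<Rightarrow> 'a::ab_group_add \<Rightarrow> 'a"
    and Basis :: "'a set"
    and D :: "'a set set"
    and S :: "'a set"
    and q t v k lam s :: nat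
  assumes "q = CARD('f)"
    and "finite_dimensional_vector_space scale Basis"
    and "vector_space.dim scale (UNIV :: 'a set) = v"
    and "t \<le> k"
    and "subspace_design scale t v k lam D"
    and "module.subspace scale S"
    and "s = vector_space.dim scale S"
  shows "\<forall>i\<in>{0..t}.
    real (intersection_number scale D S i) =
      gauss_binomial q s i *
        (\<Sum>j=i..t. (- 1) ^ (j - i) * real q ^ ((j - i) choose 2) *
           gauss_binomial q (s - i) (j - i) * design_lambda q t v k lam j)
      + (- 1) ^ (t + 1 - i) * real q ^ ((t + 1 - i) choose 2) *
        (\<Sum>j=t+1..k. gauss_binomial q j i * gauss_binomial q (j - i - 1) (t - i) *
           real (intersection_number scale D S j))"
proof -
  interpret finite_dimensional_vector_space scale Basis by fact
  interpret finite_vector_space scale Basis q by unfold_locales fact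
  show ?thesis
    using intersection_number_formula assms by simp
qed

end
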